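(* Let $G$ be a group and $N$ a normal subgroup of $G$ contained in the commutator subgroup $G'$. Let $\rho_1,\rho_2\in\mathrm{Hom}(G,\mathrm{Homeo}_+(S^1))_{\mathrm{basic}}$. If $\rho_1$ is semi-conjugate to $\rho_2$, then $\Phi(\rho_1)=\Phi(\rho_2)$. In particular, $\Phi$ descends to a map $$\mathrm{Hom}(G,\mathrm{Homeo}_+(S^1))_{\mathrm{basic}}/\text{semi-conjugacy}\to\mathrm{Q}(N)^G/\mathrm{H}^1(N;\mathbb{R})^G.$$
   Context: A homogeneous quasimorphism on a group $K$ is a function $\mu\colon K\to\mathbb{R}$ with $\sup_{g,h\in K}|\mu(gh)-\mu(g)-\mu(h)|<\infty$ and $\mu(g^n)=n\mu(g)$ for all $g\in K$, $n\in\mathbb{Z}$. $\mathrm{Q}(N)^G$ is the space of homogeneous quasimorphisms $\mu$ on $N$ with $\mu(gxg^{-1})=\mu(x)$ for all $g\in G$, $x\in N$; $\mathrm{H}^1(N;\mathbb{R})^G$ is the space of homomorphisms $N\to\mathbb{R}$ invariant under $G$-conjugation. $C^n(K;\mathbb{R})$ is the space of functions $K^n\to\mathbb{R}$ with the usual inhomogeneous coboundary $\delta$, e.g. $\delta u(g,h)=u(h)-u(gh)+u(g)$. A cocycle is normalized if it vanishes whenever one of its arguments is the identity. $S^1=\mathbb{R}/\mathbb{Z}$. $\widetilde{\mathcal{H}}$ is the group of homeomorphisms $\widetilde f$ of $\mathbb{R}$ commuting with $x\mapsto x+1$, projecting to the group $\mathrm{Homeo}_+(S^1)$ of orientation preserving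 homeomorphisms of $S^1$. Let $\tau(\widetilde f)=\lim_{n\to\infty}\widetilde f^n(0)/n$ be the Poincaré translation number, and $\chi_b(f,g)=\tau(\widetilde f\widetilde g)-\tau(\widetilde f)-\tau(\widetilde g)$ (any lifts $\widetilde f,\widetilde g\in\widetilde{\mathcal{H}}$) the canonical bounded Euler cocycle on $\mathrm{Homeo}_+(S^1)$, with class $e_{\mathbb{R}}\in\mathrm{H}^2(\mathrm{Homeo}_+(S^1);\mathbb{R})$. Let $\Gamma=G/N$ and $p\colon G\to\Gamma$ be the projection. $\mathrm{Hom}(G,\mathrm{Homeo}_+(S^1))_{\mathrm{basic}}$ is the set of homomorphisms $\rho\colon G\to\mathrm{Homeo}_+(S^1)$ with $\rho^*e_{\mathbb{R}}\in p^*(\mathrm{H}^2(\Gamma;\mathbb{R}))$. For such $\rho$ there exist a normalized $2$-cocycle $A\in C^2(\Gamma;\mathbb{R})$ and $u\in C^1(G;\mathbb{R})$ with $\rho^*\chi_b-p^*A=\delta u$; then $u|_N\in\mathrm{Q}(N)^G$, and, since $N\subset G'$, its class in $\mathrm{Q}(N)^G/\mathrm{H}^1(N;\mathbb{R})^G$ does not depend on the choice of $(A,u)$. One sets $\Phi(\rho)=[u|_N]\in\mathrm{Q}(N)^G/\mathrm{H}^1(N;\mathbb{R})^G$. Two homomorphisms $\rho_1,\rho_2\colon G\to\mathrm{Homeo}_+(S^1)$ are semi-conjugate if there exist a monotone (not necessarily continuous) map $\widetilde f\colon\mathbb{R}\to\mathbb{R}$ with $\widetilde f(x+1)=\widetilde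 f(x)+1$ for all $x\in\mathbb{R}$ and, for every $g\in G$, lifts $\widetilde\rho_1(g),\widetilde\rho_2(g)\in\widetilde{\mathcal{H}}$ of $\rho_1(g),\rho_2(g)$ such that $\widetilde\rho_1(g)(\widetilde f(x))=\widetilde f(\widetilde\rho_2(g)(x))$ for all $g\in G$, $x\in\mathbb{R}$. This is an equivalence relation on $\mathrm{Hom}(G,\mathrm{Homeo}_+(S^1))$. *)

theory Defs
  imports "HOL-Analysis.Analysis" "HOL-Algebra.Algebra" "HOL-Library.NList"
begin

section \<open>Group cohomology with real coefficients\<close>

definition real_group :: "real monoid" where
  "real_group = \<lparr>carrier = UNIV, mult = (+), one = 0\<rparr>"

text \<open>An element of \<open>K\<^sup>n\<close> is a list of length \<open>n\<close> over \<^term>\<open>carrier K\<close>. Cochains are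
  extensional, that is, \<^const>\<open>undefined\<close> off \<open>K\<^sup>n\<close>, so that equality of cochains is
  equality on \<open>K\<^sup>n\<close>.\<close>

definition cochain_group :: "('a, 'm) monoid_scheme \<Rightarrow> nat \<Rightarrow> ('a list \<Rightarrow> real) monoid" where
  "cochain_group K n = product_group (nlists n (carrier K)) (\<lambda>_. real_group)"

abbreviation cochains :: "('a, 'm) monoid_scheme \<Rightarrow> nat \<Rightarrow> ('a list \<Rightarrow> real) set" where
  "cochains K n \<equiv> carrier (cochain_group K n)"

definition coboundary ::
    "('a, 'm) monoid_scheme \<Rightarrow> nat \<Rightarrow> ('a list \<Rightarrow> real) \<Rightarrow> 'a list \<Rightarrow> real" where
  "coboundary K n u = (\<lambda>xs\<in>nlists (Suc n) (carrier K).
     u (tl xs)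
     + (\<Sum>i=1..n. (-1) ^ i * u (take (i - 1) xs @ [xs ! (i - 1) \<otimes>\<^bsub>K\<^esub> xs ! i] @ drop (i + 1) xs))
     + (-1) ^ (n + 1) * u (butlast xs))"

lemma coboundary_1:
  assumes "g \<in> carrier K" "h \<in> carrier K"
  shows "coboundary K 1 u [g, h] = u [h] - u [g \<otimes>\<^bsub>K\<^esub> h] + u [g]"
proof -
  have "[g, h] \<in> nlists (Suc 1) (carrier K)"
    using assms by (intro nlistsI) simp_all
  then show ?thesis
    unfolding coboundary_def restrict_def by (simp only: if_True) simp
qed

definition cocycles :: "('a, 'm) monoid_scheme \<Rightarrow> nat \<Rightarrow> ('a list \<Rightarrow> real) set" where
  "cocycles K n =
     {c \<in> cochains K n. coboundary K n c = \<one>\<^bsub>cochain_group K (Suc n)\<^esub>}"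

definition coboundaries :: "('a, 'm) monoid_scheme \<Rightarrow> nat \<Rightarrow> ('a list \<Rightarrow> real) set" where
  "coboundaries K n =
     (case n of 0 \<Rightarrow> {\<one>\<^bsub>cochain_group K 0\<^esub>} | Suc m \<Rightarrow> coboundary K m ` cochains K m)"

definition cohomology :: "('a, 'm) monoid_scheme \<Rightarrow> nat \<Rightarrow> ('a list \<Rightarrow> real) set monoid" where
  "cohomology K n = (cochain_group K n)\<lparr>carrier := cocycles K n\<rparr> Mod coboundaries K n"

definition cohomology_class ::
    "('a, 'm) monoid_scheme \<Rightarrow> nat \<Rightarrow> ('a list \<Rightarrow> real) \<Rightarrow> ('a list \<Rightarrow> real) set" where
  "cohomology_class K n c = coboundaries K n #>\<^bsub>cochain_group K n\<^esub> c"

definition pullback ::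
    "('a, 'm) monoid_scheme \<Rightarrow> nat \<Rightarrow> ('a \<Rightarrow> 'b) \<Rightarrow> ('b list \<Rightarrow> real) \<Rightarrow> 'a list \<Rightarrow> real" where
  "pullback K n \<phi> c = (\<lambda>xs\<in>nlists n (carrier K). c (map \<phi> xs))"

text \<open>For a homomorphism \<open>\<phi>\<close> into the group that \<open>\<xi>\<close> is a cohomology class of, the image
  below is a singleton, because pulling back commutes with the coboundary.\<close>

definition cohomology_pullback ::
    "('a, 'm) monoid_scheme \<Rightarrow> nat \<Rightarrow> ('a \<Rightarrow> 'b) \<Rightarrow> ('b list \<Rightarrow> real) set \<Rightarrow> ('a list \<Rightarrow> real) set" where
  "cohomology_pullback K n \<phi> \<xi> = the_elem ((\<lambda>c. cohomology_class K n (pullback K n \<phi> c)) ` \<xi>)"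

definition normalized :: "('a, 'm) monoid_scheme \<Rightarrow> nat \<Rightarrow> ('a list \<Rightarrow> real) \<Rightarrow> bool" where
  "normalized K n c \<longleftrightarrow> (\<forall>xs\<in>nlists n (carrier K). \<one>\<^bsub>K\<^esub> \<in> set xs \<longrightarrow> c xs = 0)"


section \<open>Invariant homogeneous quasimorphisms\<close>

definition homogeneous_quasimorphism :: "('a, 'm) monoid_scheme \<Rightarrow> ('a \<Rightarrow> real) \<Rightarrow> bool" where
  "homogeneous_quasimorphism K \<mu> \<longleftrightarrow>
     (\<exists>D. \<forall>g\<in>carrier K. \<forall>h\<in>carrier K. \<bar>\<mu> (g \<otimes>\<^bsub>K\<^esub> h) - \<mu> g - \<mu> h\<bar> \<le> D) \<and>
     (\<forall>g\<in>carrier K. \<forall>n::int. \<mu> (g [^]\<^bsub>K\<^esub> n) = of_int n * \<mu> g)"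

definition conj_invariant :: "('a, 'm) monoid_scheme \<Rightarrow> 'a set \<Rightarrow> ('a \<Rightarrow> real) \<Rightarrow> bool" where
  "conj_invariant G N \<mu> \<longleftrightarrow>
     (\<forall>g\<in>carrier G. \<forall>x\<in>N. \<mu> (g \<otimes>\<^bsub>G\<^esub> x \<otimes>\<^bsub>G\<^esub> inv\<^bsub>G\<^esub> g) = \<mu> x)"

text \<open>\<open>Q(N)\<^sup>G\<close> as an additive group; its elements are extensional functions on \<open>N\<close>.\<close>

definition invariant_quasimorphisms ::
    "('a, 'm) monoid_scheme \<Rightarrow> 'a set \<Rightarrow> ('a \<Rightarrow> real) monoid" where
  "invariant_quasimorphisms G N = (product_group N (\<lambda>_. real_group))
     \<lparr>carrier := {\<mu> \<in> extensional N.
        homogeneous_quasimorphism (G\<lparr>carrier := N\<rparr>) \<mu> \<and> conj_invariant G N \<mu>}\<rparr>"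

definition invariant_homs :: "('a, 'm) monoid_scheme \<Rightarrow> 'a set \<Rightarrow> ('a \<Rightarrow> real) set" where
  "invariant_homs G N =
     {\<mu> \<in> extensional N. \<mu> \<in> hom (G\<lparr>carrier := N\<rparr>) real_group \<and> conj_invariant G N \<mu>}"


section \<open>Homeomorphisms of the circle\<close>

quotient_type circle = real / "\<lambda>x y::real. x - y \<in> \<int>"
proof (intro equivpI reflpI sympI transpI)
  fix x y z :: real
  show "x - x \<in> \<int>" by simp
  show "y - x \<in> \<int>" if "x - y \<in> \<int>"
    using Ints_minus[OF that] by simp
  show "x - z \<in> \<int>" if "x - y \<in> \<int>" "y - z \<in> \<int>"
    using Ints_add[OF that] by simp
qed

instantiation circle :: topological_space
begin

definition open_circle :: "circle set \<Rightarrow> bool" where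
  "open_circle U \<longleftrightarrow> open (abs_circle -` U)"

instance
proof
  show "open (UNIV :: circle set)"
    by (simp add: open_circle_def)
  show "open (U \<inter> V)" if "open U" "open V" for U V :: "circle set"
    using that by (simp add: open_circle_def open_Int)
  show "open (\<Union>\<U>)" if "\<forall>U\<in>\<U>. open U" for \<U> :: "circle set set"
    using that by (simp add: open_circle_def vimage_Union open_UN)
qed

end

text \<open>The group of homeomorphisms of the line commuting with the unit translation; by
  periodicity they are automatically increasing.\<close>

definition Homeo_tilde :: "(real \<Rightarrow> real) monoid" where
  "Homeo_tilde =
     \<lparr>carrier = {F. (\<exists>F'. homeomorphism UNIV UNIV F F') \<and> (\<forall>x. F (x + 1) = F x + 1)},
      mult = (\<circ>), one = id\<rparr>"

definition covers :: "(real \<Rightarrow> real) \<Rightarrow> (circle \<Rightarrow> circle) \<Rightarrow> bool" where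
  "covers F f \<longleftrightarrow> (\<forall>x. f (abs_circle x) = abs_circle (F x))"

definition orientation_preserving :: "(circle \<Rightarrow> circle) \<Rightarrow> bool" where
  "orientation_preserving f \<longleftrightarrow> (\<exists>F. continuous_on UNIV F \<and> strict_mono F \<and> covers F f)"

definition Homeo_plus :: "(circle \<Rightarrow> circle) monoid" where
  "Homeo_plus =
     \<lparr>carrier = {f. (\<exists>f'. homeomorphism UNIV UNIV f f') \<and> orientation_preserving f},
      mult = (\<circ>), one = id\<rparr>"

definition lifts :: "(circle \<Rightarrow> circle) \<Rightarrow> (real \<Rightarrow> real) set" where
  "lifts f = {F \<in> carrier Homeo_tilde. covers F f}"

definition translation_number :: "(real \<Rightarrow> real) \<Rightarrow> real" where
  "translation_number F = lim (\<lambda>n. (F ^^ n) 0 / real n)"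

text \<open>The choice of lifts is immaterial, as \<open>\<tau>(F + k) = \<tau>(F) + k\<close> for integers \<open>k\<close>.\<close>

definition euler_cocycle :: "(circle \<Rightarrow> circle) list \<Rightarrow> real" where
  "euler_cocycle = (\<lambda>fs\<in>nlists 2 (carrier Homeo_plus).
     let F = (SOME F. F \<in> lifts (fs ! 0)); H = (SOME H. H \<in> lifts (fs ! 1))
     in translation_number (F \<circ> H) - translation_number F - translation_number H)"

definition euler_class :: "((circle \<Rightarrow> circle) list \<Rightarrow> real) set" where
  "euler_class = cohomology_class Homeo_plus 2 euler_cocycle"


section \<open>Basic actions, the map \<open>\<Phi>\<close> and semi-conjugacy\<close>

definition basic_homs ::
    "('a, 'm) monoid_scheme \<Rightarrow> 'a set \<Rightarrow> ('a \<Rightarrow> circle \<Rightarrow> circle) set" where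
  "basic_homs G N = {\<rho> \<in> hom G Homeo_plus.
     cohomology_pullback G 2 \<rho> euler_class
       \<in> cohomology_pullback G 2 (\<lambda>g. N #>\<^bsub>G\<^esub> g) ` carrier (cohomology (G Mod N) 2)}"

definition Phi_data ::
    "('a, 'm) monoid_scheme \<Rightarrow> 'a set \<Rightarrow> ('a \<Rightarrow> circle \<Rightarrow> circle) \<Rightarrow>
     ('a set list \<Rightarrow> real) \<Rightarrow> ('a list \<Rightarrow> real) \<Rightarrow> bool" where
  "Phi_data G N \<rho> A u \<longleftrightarrow>
     A \<in> cocycles (G Mod N) 2 \<and> normalized (G Mod N) 2 A \<and> u \<in> cochains G 1 \<and>
     (\<forall>xs\<in>nlists 2 (carrier G).
        pullback G 2 \<rho> euler_cocycle xs - pullback G 2 (\<lambda>g. N #>\<^bsub>G\<^esub> g) A xs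
          = coboundary G 1 u xs)"

abbreviation Phi_target :: "('a, 'm) monoid_scheme \<Rightarrow> 'a set \<Rightarrow> ('a \<Rightarrow> real) set monoid" where
  "Phi_target G N \<equiv> invariant_quasimorphisms G N Mod invariant_homs G N"

definition Phi ::
    "('a, 'm) monoid_scheme \<Rightarrow> 'a set \<Rightarrow> ('a \<Rightarrow> circle \<Rightarrow> circle) \<Rightarrow> ('a \<Rightarrow> real) set" where
  "Phi G N \<rho> = (THE c. \<exists>A u. Phi_data G N \<rho> A u \<and>
     c = invariant_homs G N #>\<^bsub>invariant_quasimorphisms G N\<^esub> (\<lambda>x\<in>N. u [x]))"

text \<open>A monotone map satisfying the equivariance condition is necessarily non-decreasing.\<close>

definition semiconjugate ::
    "('a, 'm) monoid_scheme \<Rightarrow> ('a \<Rightarrow> circle \<Rightarrow> circle) \<Rightarrow> ('a \<Rightarrow> circle \<Rightarrow> circle) \<Rightarrow> bool" where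
  "semiconjugate G \<rho>\<^sub>1 \<rho>\<^sub>2 \<longleftrightarrow>
     (\<exists>f::real \<Rightarrow> real. mono f \<and> (\<forall>x. f (x + 1) = f x + 1) \<and>
        (\<forall>g\<in>carrier G. \<exists>R\<^sub>1\<in>lifts (\<rho>\<^sub>1 g). \<exists>R\<^sub>2\<in>lifts (\<rho>\<^sub>2 g). \<forall>x. R\<^sub>1 (f x) = f (R\<^sub>2 x)))"

definition semiconjugacy ::
    "('a, 'm) monoid_scheme \<Rightarrow> 'a set \<Rightarrow>
     (('a \<Rightarrow> circle \<Rightarrow> circle) \<times> ('a \<Rightarrow> circle \<Rightarrow> circle)) set" where
  "semiconjugacy G N =
     {(\<rho>\<^sub>1, \<rho>\<^sub>2). \<rho>\<^sub>1 \<in> basic_homs G N \<and> \<rho>\<^sub>2 \<in> basic_homs G N \<and> semiconjugate G \<rho>\<^sub>1 \<rho>\<^sub>2}"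

end

theory Submission
  imports Defs
begin

text \<open>The translation number of a monotone map of degree one is the average displacement along any
  orbit. A monotone map of degree one moves points by a bounded amount, so intertwining two such
  maps by a third forces their translation numbers to agree
  (\<open>translation_number_semiconjugate\<close>). If \<open>f\<close> semi-conjugates \<open>\<rho>\<^sub>1\<close> to \<open>\<rho>\<^sub>2\<close>, it intertwines the chosen
  lifts of \<open>\<rho>\<^sub>i(g)\<close> and \<open>\<rho>\<^sub>i(h)\<close>, and hence also their products; the three terms of the Euler
  cocycle therefore agree, and the two pullbacks of the cocycle to \<open>G\<close> are \<^emph>\<open>equal\<close>, not merely
  cohomologous. Consequently the same pairs \<open>(A, u)\<close> serve for both actions and
  \<open>\<Phi>(\<rho>\<^sub>1) = \<Phi>(\<rho>\<^sub>2)\<close>.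

  For \<open>\<Phi>\<close> to descend to a map with values in \<open>Q(N)\<^sup>G / H\<^sup>1(N)\<^sup>G\<close>, it must be well defined. Where one
  argument lies in \<open>N\<close>, the normalized cocycle \<open>A\<close> pulls back to zero, so \<open>u\<close> is a primitive of the
  Euler cocycle itself (\<open>Phi_data_euler_cocycle\<close>). All properties of \<open>u\<close> on \<open>N\<close> are read off from
  corresponding properties of that cocycle: it is bounded, so \<open>u\<close> is a quasimorphism; it vanishes
  on commuting pairs, so \<open>u\<close> is homogeneous; it takes the same value on \<open>(g, x)\<close> and
  \<open>(g x g\<^sup>-\<^sup>1, g)\<close>, so \<open>u\<close> is invariant under conjugation. The difference of two primitives has
  zero coboundary on \<open>N\<close>, hence is an invariant homomorphism.\<close>

section \<open>Translation numbers of monotone maps of degree one\<close>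

text \<open>A semi-conjugacy need not be continuous, so the estimates below are made for monotone maps
  that commute with the unit translation, continuous or not.\<close>

definition degree_one :: "(real \<Rightarrow> real) \<Rightarrow> bool" where
  "degree_one F \<longleftrightarrow> mono F \<and> (\<forall>x. F (x + 1) = F x + 1)"

lemma degree_one_id: "degree_one id"
  by (simp add: degree_one_def mono_def)

lemma degree_one_comp: "degree_one F \<Longrightarrow> degree_one H \<Longrightarrow> degree_one (F \<circ> H)"
  by (simp add: degree_one_def mono_def)

lemma degree_one_funpow: "degree_one F \<Longrightarrow> degree_one (F ^^ n)"
  by (induction n) (simp_all add: degree_one_id degree_one_comp flip: id_def)

lemma commutes_with_integer_translation:
  fixes F :: "real \<Rightarrow> real"
  assumes "\<And>x. F (x + 1) = F x + 1"
  shows "F (x + of_int k) = F x + of_int k"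
proof (induction k rule: int_induct[where k = 0])
  case base
  show ?case by simp
next
  case (step1 i)
  then show ?case using assms[of "x + of_int i"] by (simp add: algebra_simps)
next
  case (step2 i)
  then show ?case using assms[of "x + of_int i - 1"] by (simp add: algebra_simps)
qed

text \<open>The displacement \<open>F x - x\<close> is periodic, and over one period it cannot vary by more than the
  length of the period because \<open>F\<close> is monotone.\<close>

lemma degree_one_displacement:
  assumes "degree_one F"
  shows "\<bar>(F x - x) - (F y - y)\<bar> \<le> 1"
proof -
  define k where "k = \<lfloor>x - y\<rfloor>"
  have k: "y + of_int k \<le> x" "x \<le> y + of_int (k + 1)"
    unfolding k_def by linarith+
  have "F (y + of_int k) \<le> F x" "F x \<le> F (y + of_int (k + 1))"
    using assms k by (simp_all add: degree_one_def mono_def del: of_int_add)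
  moreover have F: "F (y + of_int j) = F y + of_int j" for j
    using assms by (intro commutes_with_integer_translation) (simp add: degree_one_def)
  ultimately have "F y + of_int k \<le> F x" "F x \<le> F y + of_int (k + 1)"
    by (simp_all only: F)
  then show ?thesis using k by simp
qed

text \<open>Splitting \<open>m n\<close> into \<open>m\<close> blocks of length \<open>n\<close> costs at most \<open>(m + 1) D\<close>, so \<open>a (m n) / (m n)\<close>
  is within \<open>2 D / n\<close> of \<open>a n / n\<close>, and by symmetry within \<open>2 D / m\<close> of \<open>a m / m\<close>. The averages
  therefore form a Cauchy sequence.\<close>

lemma almost_additive_average_converges:
  fixes a :: "nat \<Rightarrow> real"
  assumes D: "\<And>m n. \<bar>a (m + n) - a m - a n\<bar> \<le> D"
  shows "convergent (\<lambda>n. a n / real n)"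
proof -
  have D0: "D \<ge> 0" using D[of 0 0] by linarith
  have mult: "\<bar>a (m * n) - real m * a n\<bar> \<le> real (Suc m) * D" for m n
  proof (induction m)
    case 0
    show ?case using D[of 0 0] by simp
  next
    case (Suc m)
    have "\<bar>a (m * n + n) - a (m * n) - a n\<bar> \<le> D" by (rule D)
    then show ?case using Suc by (simp add: algebra_simps)
  qed
  have avg: "\<bar>a (m * n) / real (m * n) - a n / real n\<bar> \<le> 2 * D / real n"
    if "m > 0" "n > 0" for m n
  proof -
    have "a (m * n) / real (m * n) - a n / real n = (a (m * n) - real m * a n) / real (m * n)"
      using that by (simp add: field_simps)
    then have "\<bar>a (m * n) / real (m * n) - a n / real n\<bar> = \<bar>a (m * n) - real m * a n\<bar> / real (m * n)"
      by (simp add: abs_divide)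
    also have "\<dots> \<le> (real (Suc m) * D) / real (m * n)"
      by (intro divide_right_mono mult) simp
    also have "\<dots> \<le> (2 * real m * D) / real (m * n)"
      using that D0 by (intro divide_right_mono mult_right_mono) auto
    also have "\<dots> = 2 * D / real n"
      using that by simp
    finally show ?thesis .
  qed
  have close: "\<bar>a m / real m - a n / real n\<bar> \<le> 2 * D / real m + 2 * D / real n"
    if "m > 0" "n > 0" for m n
    using avg[OF that] avg[OF that(2) that(1)] by (simp add: mult.commute[of n m])
  have "Cauchy (\<lambda>n. a n / real n)"
  proof (rule metric_CauchyI)
    fix e :: real assume e: "e > 0"
    obtain M :: nat where M: "real M > 4 * D / e" by (rule reals_Archimedean2[THEN exE])
    have small: "2 * D / real n < e / 2" if "n \<ge> Suc M" for n
    proof -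
      have "4 * D / e < real n" using M that by linarith
      then show ?thesis using e that by (simp add: field_simps)
    qed
    show "\<exists>M. \<forall>m\<ge>M. \<forall>n\<ge>M. dist (a m / real m) (a n / real n) < e"
    proof (intro exI allI impI)
      fix m n assume mn: "m \<ge> Suc M" "n \<ge> Suc M"
      then show "dist (a m / real m) (a n / real n) < e"
        using close[of m n] small[OF mn(1)] small[OF mn(2)] by (simp add: dist_real_def)
    qed
  qed
  then show ?thesis by (simp add: Cauchy_convergent_iff)
qed

lemma bounded_over_n_tendsto_0:
  fixes a :: "nat \<Rightarrow> real"
  assumes "\<And>n. \<bar>a n\<bar> \<le> C"
  shows "(\<lambda>n. a n / real n) \<longlonglongrightarrow> 0"
proof (rule Lim_null_comparison)
  show "\<forall>\<^sub>F n in sequentially. norm (a n / real n) \<le> C / real n"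
    using assms by (intro always_eventually allI) (simp add: abs_divide divide_right_mono)
  show "(\<lambda>n. C / real n) \<longlonglongrightarrow> 0"
    by (rule lim_const_over_n)
qed

lemma translation_number_tendsto:
  assumes F: "degree_one F"
  shows "(\<lambda>n. (F ^^ n) x / real n) \<longlonglongrightarrow> translation_number F"
proof -
  have "convergent (\<lambda>n. (F ^^ n) 0 / real n)"
  proof (rule almost_additive_average_converges)
    fix m n
    show "\<bar>(F ^^ (m + n)) 0 - (F ^^ m) 0 - (F ^^ n) 0\<bar> \<le> 1"
      using degree_one_displacement[OF degree_one_funpow[OF F, of m], of "(F ^^ n) 0" 0]
      by (simp add: funpow_add)
  qed
  then have "(\<lambda>n. (F ^^ n) 0 / real n) \<longlonglongrightarrow> translation_number F"
    by (simp add: translation_number_def convergent_LIMSEQ_iff)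
  moreover have "(\<lambda>n. ((F ^^ n) x - (F ^^ n) 0) / real n) \<longlonglongrightarrow> 0"
  proof (rule bounded_over_n_tendsto_0)
    fix n show "\<bar>(F ^^ n) x - (F ^^ n) 0\<bar> \<le> 1 + \<bar>x\<bar>"
      using degree_one_displacement[OF degree_one_funpow[OF F, of n], of x 0] by linarith
  qed
  ultimately have "(\<lambda>n. (F ^^ n) 0 / real n + ((F ^^ n) x - (F ^^ n) 0) / real n)
      \<longlonglongrightarrow> translation_number F + 0"
    by (rule tendsto_add)
  then show ?thesis by (simp flip: add_divide_distrib)
qed

text \<open>The orbits of \<open>H\<close> are carried to orbits of \<open>F\<close> by \<open>f\<close>, which moves points by a bounded
  amount and so does not affect averages.\<close>

lemma translation_number_semiconjugate:
  assumes F: "degree_one F" and H: "degree_one H" and f: "degree_one f"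
    and eq: "\<And>x. F (f x) = f (H x)"
  shows "translation_number F = translation_number H"
proof -
  have iter: "(F ^^ n) (f x) = f ((H ^^ n) x)" for n x
    by (induction n) (simp_all add: eq)
  have "(\<lambda>n. (f ((H ^^ n) 0) - (H ^^ n) 0) / real n) \<longlonglongrightarrow> 0"
  proof (rule bounded_over_n_tendsto_0)
    fix n show "\<bar>f ((H ^^ n) 0) - (H ^^ n) 0\<bar> \<le> 1 + \<bar>f 0\<bar>"
      using degree_one_displacement[OF f, of "(H ^^ n) 0" 0] by linarith
  qed
  from tendsto_add[OF translation_number_tendsto[OF H, of 0] this]
  have "(\<lambda>n. (F ^^ n) (f 0) / real n) \<longlonglongrightarrow> translation_number H"
    by (simp add: iter flip: add_divide_distrib)
  with translation_number_tendsto[OF F, of "f 0"] show ?thesis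
    by (rule LIMSEQ_unique)
qed

text \<open>For commuting maps \<open>(F H)\<^sup>n = F\<^sup>n H\<^sup>n\<close>, and applying \<open>F\<^sup>n\<close> at \<open>H\<^sup>n(0)\<close> instead of \<open>0\<close> changes
  the displacement by at most \<open>1\<close>, whatever \<open>n\<close> is.\<close>

lemma translation_number_comp_commuting:
  assumes F: "degree_one F" and H: "degree_one H" and comm: "F \<circ> H = H \<circ> F"
  shows "translation_number (F \<circ> H) = translation_number F + translation_number H"
proof -
  have "H (F x) = F (H x)" for x using fun_cong[OF comm, of x] by simp
  then have swap: "H ((F ^^ n) x) = (F ^^ n) (H x)" for n x
    by (induction n) simp_all
  have iter: "((F \<circ> H) ^^ n) x = (F ^^ n) ((H ^^ n) x)" for n x
    by (induction n) (simp_all add: swap)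
  have "(\<lambda>n. ((F ^^ n) ((H ^^ n) 0) - (F ^^ n) 0 - (H ^^ n) 0) / real n) \<longlonglongrightarrow> 0"
  proof (rule bounded_over_n_tendsto_0)
    fix n show "\<bar>(F ^^ n) ((H ^^ n) 0) - (F ^^ n) 0 - (H ^^ n) 0\<bar> \<le> 1"
      using degree_one_displacement[OF degree_one_funpow[OF F, of n], of "(H ^^ n) 0" 0] by simp
  qed
  from tendsto_add[OF tendsto_add[OF translation_number_tendsto[OF F, of 0]
        translation_number_tendsto[OF H, of 0]] this]
  have "(\<lambda>n. ((F \<circ> H) ^^ n) 0 / real n) \<longlonglongrightarrow> translation_number F + translation_number H"
    by (simp add: iter flip: add_divide_distrib)
  with translation_number_tendsto[OF degree_one_comp[OF F H], of 0] show ?thesis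
    by (rule LIMSEQ_unique)
qed

lemma translation_number_add_int:
  assumes F: "degree_one F"
  shows "translation_number (\<lambda>x. F x + of_int k) = translation_number F + of_int k"
proof -
  define T :: "real \<Rightarrow> real" where "T = (\<lambda>x. x + of_int k)"
  have T: "degree_one T" by (simp add: degree_one_def T_def mono_def)
  have "(T ^^ n) 0 = real n * of_int k" for n
    by (induction n) (simp_all add: T_def algebra_simps)
  then have "(T ^^ n) 0 / real n = of_int k" if "n > 0" for n
    using that by simp
  then have "\<forall>\<^sub>F n in sequentially. (T ^^ n) 0 / real n = of_int k"
    by (intro eventually_sequentiallyI[of 1]) simp
  then have "(\<lambda>n. (T ^^ n) 0 / real n) \<longlonglongrightarrow> of_int k"
    by (rule tendsto_eventually)
  with translation_number_tendsto[OF T, of 0] have tauT: "translation_number T = of_int k"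
    by (rule LIMSEQ_unique)
  have "T \<circ> F = F \<circ> T"
    using commutes_with_integer_translation[of F] F by (auto simp: T_def degree_one_def fun_eq_iff)
  from translation_number_comp_commuting[OF T F this] tauT show ?thesis
    by (simp add: T_def comp_def)
qed

lemma translation_number_near_displacement:
  assumes F: "degree_one F"
  shows "\<bar>translation_number F - F 0\<bar> \<le> 1"
proof -
  have iter: "\<bar>(F ^^ n) 0 - real n * F 0\<bar> \<le> real n" for n
  proof (induction n)
    case (Suc n)
    then show ?case
      using degree_one_displacement[OF F, of "(F ^^ n) 0" 0] by (simp add: algebra_simps)
  qed simp
  have "\<bar>(F ^^ n) 0 / real n - F 0\<bar> \<le> 1" if "n \<ge> 1" for n
  proof -
    have "(F ^^ n) 0 / real n - F 0 = ((F ^^ n) 0 - real n * F 0) / real n"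
      using that by (simp add: field_simps)
    then show ?thesis using iter[of n] that by (simp add: abs_divide)
  qed
  moreover have "(\<lambda>n. \<bar>(F ^^ n) 0 / real n - F 0\<bar>) \<longlonglongrightarrow> \<bar>translation_number F - F 0\<bar>"
    by (intro tendsto_intros translation_number_tendsto F)
  ultimately show ?thesis
    by (intro LIMSEQ_le_const2) auto
qed

lemma translation_number_comp_bounded:
  assumes F: "degree_one F" and H: "degree_one H"
  shows "\<bar>translation_number (F \<circ> H) - translation_number F - translation_number H\<bar> \<le> 4"
  using translation_number_near_displacement[OF F] translation_number_near_displacement[OF H]
    translation_number_near_displacement[OF degree_one_comp[OF F H]]
    degree_one_displacement[OF F, of "H 0" 0]
  by simp

section \<open>Lifts of circle homeomorphisms\<close>

lemma degree_one_Homeo_tilde: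
  assumes "F \<in> carrier Homeo_tilde"
  shows "degree_one F"
proof -
  from assms obtain F' where h: "homeomorphism UNIV UNIV F F'" and c: "\<And>x. F (x + 1) = F x + 1"
    by (auto simp: Homeo_tilde_def)
  have "continuous_on UNIV F" "inj F"
    using h by (auto simp: homeomorphism_def intro: inj_on_inverseI)
  then have "strict_mono F \<or> strict_antimono_on UNIV F"
    using injective_eq_monotone_map[of UNIV F] by simp
  moreover have "\<not> strict_antimono_on UNIV F"
  proof
    assume "strict_antimono_on UNIV F"
    then have "F (0 + 1) < F 0" unfolding monotone_on_def by force
    then show False using c[of 0] by simp
  qed
  ultimately show ?thesis
    using c by (auto simp: degree_one_def strict_mono_mono)
qed

lemma abs_circle_eq_iff: "abs_circle x = abs_circle y \<longleftrightarrow> x - y \<in> \<int>"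
  by (rule circle.abs_eq_iff)

lemma continuous_Ints_valued_constant:
  fixes d :: "real \<Rightarrow> real"
  assumes cont: "continuous_on UNIV d" and int: "\<And>x. d x \<in> \<int>"
  obtains k :: int where "\<And>x. d x = of_int k"
proof -
  have "d constant_on UNIV"
  proof (rule continuous_discrete_range_constant[OF _ cont])
    show "\<exists>e>0. \<forall>y. y \<in> UNIV \<and> d y \<noteq> d x \<longrightarrow> e \<le> norm (d y - d x)" for x
    proof (intro exI conjI allI impI)
      fix y assume "y \<in> UNIV \<and> d y \<noteq> d x"
      with int[of x] int[of y] show "1 \<le> norm (d y - d x)"
        using Ints_nonzero_abs_ge1[OF Ints_diff[OF int int], of y x] by simp
    qed simp
  qed simp
  then obtain c where "\<And>x. d x = c" by (auto simp: constant_on_def)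
  moreover from int[of 0] obtain k :: int where "d 0 = of_int k" by (auto elim: Ints_cases)
  ultimately show ?thesis using that by metis
qed

lemma lifts_differ_by_int:
  assumes "F \<in> lifts f" "F' \<in> lifts f"
  obtains k :: int where "F' = (\<lambda>x. F x + of_int k)"
proof -
  have "continuous_on UNIV F" "continuous_on UNIV F'"
    using assms by (auto simp: lifts_def Homeo_tilde_def homeomorphism_def)
  moreover have "F' x - F x \<in> \<int>" for x
    using assms by (simp add: lifts_def covers_def flip: abs_circle_eq_iff)
  ultimately obtain k :: int where "\<And>x. F' x - F x = of_int k"
    using continuous_Ints_valued_constant[of "\<lambda>x. F' x - F x"] continuous_on_diff by blast
  then have "F' = (\<lambda>x. F x + of_int k)"
    by (auto simp: fun_eq_iff algebra_simps)
  then show ?thesis by (rule that)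
qed

lemma lifts_comp:
  assumes "F \<in> lifts f" "H \<in> lifts h"
  shows "F \<circ> H \<in> lifts (f \<circ> h)"
  using assms homeomorphism_compose[of UNIV UNIV _ _ UNIV]
  by (fastforce simp: lifts_def Homeo_tilde_def covers_def)

lemma degree_one_lift: "F \<in> lifts f \<Longrightarrow> degree_one F"
  by (simp add: lifts_def degree_one_Homeo_tilde)

text \<open>An increasing map covering \<open>f\<close> advances by a positive integer over each unit interval;
  were it at least \<open>2\<close>, two points less than \<open>1\<close> apart would have images differing by exactly
  \<open>1\<close>, contradicting injectivity of \<open>f\<close>.\<close>

lemma lifts_nonempty:
  assumes "f \<in> carrier Homeo_plus"
  shows "\<exists>F. F \<in> lifts f"
proof -
  from assms obtain f' F where hf: "homeomorphism UNIV UNIV f f'"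
    and cont: "continuous_on UNIV F" and mono: "strict_mono F" and cov: "covers F f"
    by (auto simp: Homeo_plus_def orientation_preserving_def)
  have "F (x + 1) - F x \<in> \<int>" for x
  proof -
    have "abs_circle (x + 1) = abs_circle x" by (simp add: abs_circle_eq_iff)
    then show ?thesis using cov by (metis abs_circle_eq_iff covers_def)
  qed
  moreover have "continuous_on UNIV (\<lambda>x. F (x + 1) - F x)"
    by (intro continuous_intros continuous_on_compose2[OF cont]) auto
  ultimately obtain k :: int where k: "\<And>x. F (x + 1) - F x = of_int k"
    using continuous_Ints_valued_constant[of "\<lambda>x. F (x + 1) - F x"] by blast
  have "F 0 < F 1" using mono by (simp add: strict_mono_def)
  then have "k > 0" using k[of 0] by simp
  have "k < 2"
  proof (rule ccontr)
    assume "\<not> k < 2"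
    then have "F 0 + 1 < F 1" using k[of 0] by simp
    then obtain y where y: "0 \<le> y" "y \<le> 1" "F y = F 0 + 1"
      using IVT'[of F 0 "F 0 + 1" 1] continuous_on_subset[OF cont] by auto
    then have "abs_circle (F y) = abs_circle (F 0)" by (simp add: abs_circle_eq_iff)
    then have "f (abs_circle y) = f (abs_circle 0)" using cov by (simp add: covers_def)
    then have "abs_circle y = abs_circle 0" using hf by (metis UNIV_I homeomorphism_apply1)
    then have "y \<in> \<int>" by (simp add: abs_circle_eq_iff)
    moreover have "y \<noteq> 0" "y \<noteq> 1" using y \<open>F 0 + 1 < F 1\<close> by auto
    ultimately show False using y by (auto elim!: Ints_cases)
  qed
  with \<open>k > 0\<close> have "k = 1" by simp
  then have step: "F (x + 1) = F x + 1" for x using k[of x] by simp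
  have "surj F"
  proof -
    have "\<exists>x. y = F x" for y
    proof -
      define n where "n = \<lfloor>y - F 0\<rfloor>"
      have F: "F (of_int j) = F 0 + of_int j" for j
        using commutes_with_integer_translation[of F 0 j] step by simp
      have "F (of_int n) \<le> y" "y \<le> F (of_int (n + 1))"
        unfolding F n_def by linarith+
      then show ?thesis
        using IVT'[of F "of_int n" y "of_int (n + 1)"] continuous_on_subset[OF cont] by auto
    qed
    then show ?thesis by (simp add: surj_def)
  qed
  moreover have "inj F" using mono by (rule strict_mono_imp_inj_on)
  ultimately obtain F' where "homeomorphism UNIV UNIV F F'"
    using injective_into_1d_eq_homeomorphism[OF cont] by auto
  then show ?thesis using step cov by (auto simp: lifts_def Homeo_tilde_def)
qed

lemma monoid_Homeo_plus: "monoid Homeo_plus"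
proof (rule monoidI)
  fix f g assume f: "f \<in> carrier Homeo_plus" and g: "g \<in> carrier Homeo_plus"
  from f g obtain f' g' where "homeomorphism UNIV UNIV f f'" "homeomorphism UNIV UNIV g g'"
    by (auto simp: Homeo_plus_def)
  then have "homeomorphism UNIV UNIV (f \<circ> g) (g' \<circ> f')"
    by (metis homeomorphism_compose)
  moreover from f g obtain F H where "continuous_on UNIV F" "strict_mono F" "covers F f"
    and "continuous_on UNIV H" "strict_mono H" "covers H g"
    by (auto simp: Homeo_plus_def orientation_preserving_def)
  then have "continuous_on UNIV (F \<circ> H)" "strict_mono (F \<circ> H)" "covers (F \<circ> H) (f \<circ> g)"
    using continuous_on_compose[of UNIV H F] continuous_on_subset[of UNIV F "range H"]
    by (simp_all add: covers_def strict_mono_def)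
  then have "orientation_preserving (f \<circ> g)"
    unfolding orientation_preserving_def by blast
  ultimately show "f \<otimes>\<^bsub>Homeo_plus\<^esub> g \<in> carrier Homeo_plus"
    by (auto simp: Homeo_plus_def)
next
  have "homeomorphism UNIV UNIV (id :: circle \<Rightarrow> circle) id"
    by (simp add: homeomorphism_def)
  moreover have "orientation_preserving id"
    unfolding orientation_preserving_def
    by (rule exI[of _ id]) (simp add: covers_def strict_mono_def)
  ultimately show "\<one>\<^bsub>Homeo_plus\<^esub> \<in> carrier Homeo_plus"
    by (auto simp: Homeo_plus_def)
qed (simp_all add: Homeo_plus_def comp_assoc)

text \<open>Two lifts of the same commuting pair give \<open>F \<circ> H = H \<circ> F + k\<close> with \<open>k\<close> an integer; since
  \<open>F \<circ> H\<close> and \<open>H \<circ> F\<close> are conjugate by \<open>H\<close>, their translation numbers agree and \<open>k = 0\<close>.\<close>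

lemma lifts_commute:
  assumes F: "F \<in> lifts f" and H: "H \<in> lifts h" and comm: "f \<circ> h = h \<circ> f"
  shows "F \<circ> H = H \<circ> F"
proof -
  from lifts_comp[OF H F] lifts_comp[OF F H] comm
  obtain k :: int where k: "F \<circ> H = (\<lambda>x. (H \<circ> F) x + of_int k)"
    by (metis lifts_differ_by_int)
  have deg: "degree_one F" "degree_one H" using F H by (simp_all add: degree_one_lift)
  have "translation_number (H \<circ> F) = translation_number (F \<circ> H)"
    by (rule translation_number_semiconjugate[where f = H]) (simp_all only: degree_one_comp deg comp_apply)
  moreover have "translation_number (F \<circ> H) = translation_number (H \<circ> F) + of_int k"
    unfolding k by (rule translation_number_add_int) (simp only: degree_one_comp deg)
  ultimately have "k = 0" by simp
  then show ?thesis using k by (simp add: fun_eq_iff)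
qed

section \<open>The bounded Euler cocycle\<close>

lemma pair_in_nlists_2: "[g, h] \<in> nlists 2 A \<longleftrightarrow> g \<in> A \<and> h \<in> A"
  by (simp add: numeral_2_eq_2)

text \<open>Changing the lifts by integers \<open>k\<close> and \<open>l\<close> changes the translation number of the product by
  \<open>k + l\<close>, which the other two terms compensate.\<close>

lemma euler_cocycle_eq:
  assumes f: "f \<in> carrier Homeo_plus" and h: "h \<in> carrier Homeo_plus"
    and F: "F \<in> lifts f" and H: "H \<in> lifts h"
  shows "euler_cocycle [f, h]
    = translation_number (F \<circ> H) - translation_number F - translation_number H"
proof -
  define F' where "F' = (SOME F. F \<in> lifts f)"
  define H' where "H' = (SOME H. H \<in> lifts h)"
  have "F' \<in> lifts f" "H' \<in> lifts h"
    unfolding F'_def H'_def by (rule someI[of _ F], rule F) (rule someI[of _ H], rule H)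
  then obtain k l :: int where k: "F' = (\<lambda>x. F x + of_int k)" and l: "H' = (\<lambda>x. H x + of_int l)"
    using lifts_differ_by_int[OF F] lifts_differ_by_int[OF H] by metis
  have deg: "degree_one F" "degree_one H" using F H by (simp_all add: degree_one_lift)
  have "F' \<circ> H' = (\<lambda>x. (F \<circ> H) x + of_int (k + l))"
    using commutes_with_integer_translation[of F] deg
    by (simp add: k l degree_one_def fun_eq_iff)
  then have "translation_number (F' \<circ> H') = translation_number (F \<circ> H) + of_int (k + l)"
    by (simp only: translation_number_add_int degree_one_comp deg)
  moreover have "translation_number F' = translation_number F + of_int k"
    "translation_number H' = translation_number H + of_int l"
    by (simp_all only: k l translation_number_add_int deg)
  moreover have "[f, h] \<in> nlists 2 (carrier Homeo_plus)"
    using f h by (simp only: pair_in_nlists_2 simp_thms)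
  moreover from this have "euler_cocycle [f, h]
      = translation_number (F' \<circ> H') - translation_number F' - translation_number H'"
    by (simp only: euler_cocycle_def Let_def restrict_apply' nth_Cons_0 nth_Cons_Suc One_nat_def
        F'_def H'_def)
  ultimately show ?thesis by simp
qed

lemma euler_cocycle_bounded:
  assumes f: "f \<in> carrier Homeo_plus" and h: "h \<in> carrier Homeo_plus"
  shows "\<bar>euler_cocycle [f, h]\<bar> \<le> 4"
proof -
  obtain F H where "F \<in> lifts f" "H \<in> lifts h"
    using lifts_nonempty[OF f] lifts_nonempty[OF h] by blast
  with f h show ?thesis
    by (simp add: euler_cocycle_eq translation_number_comp_bounded degree_one_lift)
qed

lemma euler_cocycle_commuting:
  assumes f: "f \<in> carrier Homeo_plus" and h: "h \<in> carrier Homeo_plus" and "f \<circ> h = h \<circ> f"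
  shows "euler_cocycle [f, h] = 0"
proof -
  obtain F H where FH: "F \<in> lifts f" "H \<in> lifts h"
    using lifts_nonempty[OF f] lifts_nonempty[OF h] by blast
  then have "translation_number (F \<circ> H) = translation_number F + translation_number H"
    using lifts_commute[OF FH assms(3)]
    by (intro translation_number_comp_commuting) (simp_all add: degree_one_lift)
  with f h FH show ?thesis by (simp add: euler_cocycle_eq)
qed

text \<open>If \<open>y\<close> is the conjugate of \<open>x\<close> by \<open>f\<close>, then both sides compare the translation number of
  the same product \<open>f x = y f\<close> with those of its factors, and conjugate factors contribute
  equally.\<close>

lemma euler_cocycle_conjugate:
  assumes f: "f \<in> carrier Homeo_plus" and x: "x \<in> carrier Homeo_plus" and y: "y \<in> carrier Homeo_plus"
    and eq: "f \<circ> x = y \<circ> f"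
  shows "euler_cocycle [f, x] = euler_cocycle [y, f]"
proof -
  obtain F P Q0 where F: "F \<in> lifts f" and P: "P \<in> lifts x" and Q0: "Q0 \<in> lifts y"
    using lifts_nonempty[OF f] lifts_nonempty[OF x] lifts_nonempty[OF y] by blast
  from lifts_comp[OF Q0 F] lifts_comp[OF F P] eq
  obtain k :: int where k: "F \<circ> P = (\<lambda>z. (Q0 \<circ> F) z + of_int k)"
    by (metis lifts_differ_by_int)
  have deg: "degree_one F" "degree_one P" "degree_one Q0"
    using F P Q0 by (simp_all add: degree_one_lift)
  \<comment> \<open>Among the lifts of \<open>y\<close>, this is the exact conjugate of \<open>P\<close> by \<open>F\<close>.\<close>
  define Q where "Q = (\<lambda>z. Q0 z + of_int k)"
  have Q: "degree_one Q" using deg by (simp add: Q_def degree_one_def mono_def)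
  have tau: "translation_number Q = translation_number Q0 + of_int k"
    "translation_number (F \<circ> P) = translation_number (Q0 \<circ> F) + of_int k"
    unfolding Q_def k by (simp_all only: translation_number_add_int degree_one_comp deg)
  have "Q (F z) = F (P z)" for z using fun_cong[OF k, of z] by (simp add: Q_def)
  then have "translation_number Q = translation_number P"
    by (rule translation_number_semiconjugate[OF Q deg(2) deg(1)])
  with tau show ?thesis
    by (simp add: euler_cocycle_eq[OF f x F P] euler_cocycle_eq[OF y f Q0 F])
qed

lemma semiconjugate_imp_euler_cocycle_eq:
  assumes \<rho>\<^sub>1: "\<rho>\<^sub>1 \<in> hom G Homeo_plus" and \<rho>\<^sub>2: "\<rho>\<^sub>2 \<in> hom G Homeo_plus"
    and semi: "semiconjugate G \<rho>\<^sub>1 \<rho>\<^sub>2" and g: "g \<in> carrier G" and h: "h \<in> carrier G"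
  shows "euler_cocycle [\<rho>\<^sub>1 g, \<rho>\<^sub>1 h] = euler_cocycle [\<rho>\<^sub>2 g, \<rho>\<^sub>2 h]"
proof -
  from semi obtain f where f: "degree_one f" and lift: "\<forall>g\<in>carrier G.
      \<exists>R\<^sub>1\<in>lifts (\<rho>\<^sub>1 g). \<exists>R\<^sub>2\<in>lifts (\<rho>\<^sub>2 g). \<forall>x. R\<^sub>1 (f x) = f (R\<^sub>2 x)"
    unfolding semiconjugate_def degree_one_def by blast
  from lift g obtain F\<^sub>1 F\<^sub>2 where F: "F\<^sub>1 \<in> lifts (\<rho>\<^sub>1 g)" "F\<^sub>2 \<in> lifts (\<rho>\<^sub>2 g)"
    "\<And>x. F\<^sub>1 (f x) = f (F\<^sub>2 x)" by blast
  from lift h obtain H\<^sub>1 H\<^sub>2 where H: "H\<^sub>1 \<in> lifts (\<rho>\<^sub>1 h)" "H\<^sub>2 \<in> lifts (\<rho>\<^sub>2 h)"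
    "\<And>x. H\<^sub>1 (f x) = f (H\<^sub>2 x)" by blast
  note tau = translation_number_semiconjugate[OF _ _ f]
  have "translation_number F\<^sub>1 = translation_number F\<^sub>2" "translation_number H\<^sub>1 = translation_number H\<^sub>2"
    "translation_number (F\<^sub>1 \<circ> H\<^sub>1) = translation_number (F\<^sub>2 \<circ> H\<^sub>2)"
    by (rule tau; simp add: F H degree_one_lift[OF F(1)] degree_one_lift[OF F(2)]
        degree_one_lift[OF H(1)] degree_one_lift[OF H(2)] degree_one_comp)+
  moreover have "\<rho>\<^sub>1 g \<in> carrier Homeo_plus" "\<rho>\<^sub>1 h \<in> carrier Homeo_plus"
    "\<rho>\<^sub>2 g \<in> carrier Homeo_plus" "\<rho>\<^sub>2 h \<in> carrier Homeo_plus"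
    using \<rho>\<^sub>1 \<rho>\<^sub>2 g h by (auto simp: hom_def)
  ultimately show ?thesis using F H by (simp add: euler_cocycle_eq)
qed

section \<open>Cochains in low degree\<close>

lemma mult_real_group [simp]: "x \<otimes>\<^bsub>real_group\<^esub> y = x + y"
  and one_real_group [simp]: "\<one>\<^bsub>real_group\<^esub> = 0"
  and carrier_real_group [simp]: "carrier real_group = UNIV"
  by (simp_all add: real_group_def)

lemma ball_nlists_2: "(\<forall>xs\<in>nlists 2 A. P xs) \<longleftrightarrow> (\<forall>g\<in>A. \<forall>h\<in>A. P [g, h])"
  by (auto simp: numeral_2_eq_2 in_nlists_Suc_iff)

lemma ball_nlists_3: "(\<forall>xs\<in>nlists 3 A. P xs) \<longleftrightarrow> (\<forall>g\<in>A. \<forall>h\<in>A. \<forall>k\<in>A. P [g, h, k])"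
  by (auto simp: numeral_3_eq_3 in_nlists_Suc_iff)

lemma cochains_eq: "cochains K n = extensional (nlists n (carrier K))"
  by (simp add: cochain_group_def PiE_UNIV_domain PiE_def)

lemma mult_cochain_group:
  "b \<otimes>\<^bsub>cochain_group K n\<^esub> c = (\<lambda>xs\<in>nlists n (carrier K). b xs + c xs)"
  by (simp add: cochain_group_def)

lemma coboundary_2:
  assumes "g \<in> carrier K" "h \<in> carrier K" "k \<in> carrier K"
  shows "coboundary K 2 c [g, h, k]
    = c [h, k] - c [g \<otimes>\<^bsub>K\<^esub> h, k] + c [g, h \<otimes>\<^bsub>K\<^esub> k] - c [g, h]"
proof -
  have "[g, h, k] \<in> nlists (Suc 2) (carrier K)"
    using assms by (simp add: numeral_2_eq_2)
  then show ?thesis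
    unfolding coboundary_def restrict_def
    by (simp only: if_True) (simp add: numeral_2_eq_2 atLeastAtMostSuc_conv)
qed

lemma cocycles_2_iff:
  "c \<in> cocycles K 2 \<longleftrightarrow> c \<in> extensional (nlists 2 (carrier K)) \<and>
    (\<forall>g\<in>carrier K. \<forall>h\<in>carrier K. \<forall>k\<in>carrier K.
      c [h, k] - c [g \<otimes>\<^bsub>K\<^esub> h, k] + c [g, h \<otimes>\<^bsub>K\<^esub> k] - c [g, h] = 0)"
proof -
  have "coboundary K 2 c = \<one>\<^bsub>cochain_group K (Suc 2)\<^esub> \<longleftrightarrow>
      (\<forall>xs\<in>nlists 3 (carrier K). coboundary K 2 c xs = 0)"
    by (auto simp: cochain_group_def coboundary_def fun_eq_iff restrict_def)
  also have "\<dots> \<longleftrightarrow> (\<forall>g\<in>carrier K. \<forall>h\<in>carrier K. \<forall>k\<in>carrier K.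
      c [h, k] - c [g \<otimes>\<^bsub>K\<^esub> h, k] + c [g, h \<otimes>\<^bsub>K\<^esub> k] - c [g, h] = 0)"
    by (simp add: ball_nlists_3 coboundary_2)
  finally show ?thesis by (simp add: cocycles_def cochains_eq)
qed

lemma coboundaries_2_iff:
  assumes "monoid K"
  shows "b \<in> coboundaries K 2 \<longleftrightarrow> b \<in> extensional (nlists 2 (carrier K)) \<and>
    (\<exists>v. \<forall>g\<in>carrier K. \<forall>h\<in>carrier K. b [g, h] = v h - v (g \<otimes>\<^bsub>K\<^esub> h) + v g)"
    (is "_ \<longleftrightarrow> ?R")
proof
  assume "b \<in> coboundaries K 2"
  then obtain u where u: "b = coboundary K 1 u"
    by (auto simp: coboundaries_def numeral_2_eq_2)
  have "b \<in> extensional (nlists 2 (carrier K))"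
    unfolding u by (simp add: coboundary_def numeral_2_eq_2)
  moreover have "\<forall>g\<in>carrier K. \<forall>h\<in>carrier K. b [g, h] = u [h] - u [g \<otimes>\<^bsub>K\<^esub> h] + u [g]"
    unfolding u by (intro ballI coboundary_1)
  ultimately show ?R by (auto intro!: exI[of _ "\<lambda>g. u [g]"])
next
  assume ?R
  then obtain v where ext: "b \<in> extensional (nlists 2 (carrier K))"
    and v: "\<And>g h. g \<in> carrier K \<Longrightarrow> h \<in> carrier K \<Longrightarrow> b [g, h] = v h - v (g \<otimes>\<^bsub>K\<^esub> h) + v g"
    by blast
  define u where "u = (\<lambda>xs\<in>nlists 1 (carrier K). v (hd xs))"
  have u: "u [g] = v g" if "g \<in> carrier K" for g
    using that by (simp add: u_def)
  have "b = coboundary K 1 u"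
  proof (rule extensionalityI[OF ext])
    show "coboundary K 1 u \<in> extensional (nlists 2 (carrier K))"
      by (simp add: coboundary_def numeral_2_eq_2)
    have "\<forall>xs\<in>nlists 2 (carrier K). b xs = coboundary K 1 u xs"
      unfolding ball_nlists_2 using v u monoid.m_closed[OF assms] by (metis coboundary_1)
    then show "b xs = coboundary K 1 u xs" if "xs \<in> nlists 2 (carrier K)" for xs
      using that by blast
  qed
  moreover have "u \<in> cochains K 1" by (simp add: cochains_eq u_def)
  ultimately show "b \<in> coboundaries K 2"
    by (simp add: coboundaries_def numeral_2_eq_2)
qed

text \<open>Pointwise form of membership in a class: the two cochains differ by \<open>\<delta>v\<close>.\<close>

lemma cohomology_class_2_iff:
  assumes K: "monoid K"
  shows "d \<in> cohomology_class K 2 c \<longleftrightarrow> d \<in> extensional (nlists 2 (carrier K)) \<and>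
    (\<exists>v. \<forall>g\<in>carrier K. \<forall>h\<in>carrier K. d [g, h] = c [g, h] + (v h - v (g \<otimes>\<^bsub>K\<^esub> h) + v g))"
    (is "_ \<longleftrightarrow> ?R")
proof
  assume "d \<in> cohomology_class K 2 c"
  then obtain b where b: "b \<in> coboundaries K 2"
    and d: "d = (\<lambda>xs\<in>nlists 2 (carrier K). b xs + c xs)"
    by (auto simp: cohomology_class_def r_coset_def mult_cochain_group)
  from b obtain v where "\<And>g h. g \<in> carrier K \<Longrightarrow> h \<in> carrier K \<Longrightarrow>
      b [g, h] = v h - v (g \<otimes>\<^bsub>K\<^esub> h) + v g"
    unfolding coboundaries_2_iff[OF K] by blast
  then show ?R
    by (intro conjI exI[of _ v]) (simp_all add: d pair_in_nlists_2)
next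
  assume R: ?R
  define b where "b = (\<lambda>xs\<in>nlists 2 (carrier K). d xs - c xs)"
  have "b \<in> coboundaries K 2"
    using R by (fastforce simp: coboundaries_2_iff[OF K] pair_in_nlists_2 b_def)
  moreover have "d = b \<otimes>\<^bsub>cochain_group K 2\<^esub> c"
    using R by (auto simp: mult_cochain_group b_def fun_eq_iff extensional_def)
  ultimately show "d \<in> cohomology_class K 2 c"
    by (auto simp: cohomology_class_def r_coset_def)
qed

lemma self_in_cohomology_class_2:
  assumes "monoid K" "c \<in> extensional (nlists 2 (carrier K))"
  shows "c \<in> cohomology_class K 2 c"
  using assms by (auto simp: cohomology_class_2_iff intro!: exI[of _ "\<lambda>_. 0"])

lemma cohomology_class_2_eqI:
  assumes K: "monoid K"
    and v: "\<And>g h. g \<in> carrier K \<Longrightarrow> h \<in> carrier K \<Longrightarrow>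
      d [g, h] = c [g, h] + (v h - v (g \<otimes>\<^bsub>K\<^esub> h) + v g)"
  shows "cohomology_class K 2 d = cohomology_class K 2 c"
proof (intro equalityI subsetI)
  fix e assume "e \<in> cohomology_class K 2 d"
  then obtain w where e: "e \<in> extensional (nlists 2 (carrier K))"
    and w: "\<And>g h. g \<in> carrier K \<Longrightarrow> h \<in> carrier K \<Longrightarrow>
      e [g, h] = d [g, h] + (w h - w (g \<otimes>\<^bsub>K\<^esub> h) + w g)"
    unfolding cohomology_class_2_iff[OF K] by blast
  from e show "e \<in> cohomology_class K 2 c"
    unfolding cohomology_class_2_iff[OF K]
    by (auto simp: v w intro!: exI[of _ "\<lambda>g. v g + w g"])
next
  fix e assume "e \<in> cohomology_class K 2 c"
  then obtain w where e: "e \<in> extensional (nlists 2 (carrier K))"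
    and w: "\<And>g h. g \<in> carrier K \<Longrightarrow> h \<in> carrier K \<Longrightarrow>
      e [g, h] = c [g, h] + (w h - w (g \<otimes>\<^bsub>K\<^esub> h) + w g)"
    unfolding cohomology_class_2_iff[OF K] by blast
  from e show "e \<in> cohomology_class K 2 d"
    unfolding cohomology_class_2_iff[OF K]
    by (auto simp: v w intro!: exI[of _ "\<lambda>g. w g - v g"])
qed

lemma pullback_pair:
  "g \<in> carrier K \<Longrightarrow> h \<in> carrier K \<Longrightarrow> pullback K 2 \<phi> c [g, h] = c [\<phi> g, \<phi> h]"
  by (simp add: pullback_def pair_in_nlists_2)

text \<open>The pullbacks of all representatives of a class differ by coboundaries, so they determine
  a single class and \<open>the_elem\<close> picks it out.\<close>

lemma cohomology_pullback_class:
  assumes K: "monoid K" and L: "monoid L" and \<phi>: "\<phi> \<in> hom K L"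
  shows "cohomology_pullback K 2 \<phi> (cohomology_class L 2 c)
    = cohomology_class K 2 (pullback K 2 \<phi> c)"
proof -
  have "cohomology_class K 2 (pullback K 2 \<phi> d) = cohomology_class K 2 (pullback K 2 \<phi> c)"
    if d: "d \<in> cohomology_class L 2 c" for d
  proof -
    from d obtain v where v: "\<And>g h. g \<in> carrier L \<Longrightarrow> h \<in> carrier L \<Longrightarrow>
        d [g, h] = c [g, h] + (v h - v (g \<otimes>\<^bsub>L\<^esub> h) + v g)"
      unfolding cohomology_class_2_iff[OF L] by blast
    show ?thesis
    proof (rule cohomology_class_2_eqI[OF K, where v = "\<lambda>g. v (\<phi> g)"])
      fix g h assume gh: "g \<in> carrier K" "h \<in> carrier K"
      then show "pullback K 2 \<phi> d [g, h] = pullback K 2 \<phi> c [g, h]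
          + (v (\<phi> h) - v (\<phi> (g \<otimes>\<^bsub>K\<^esub> h)) + v (\<phi> g))"
        using v[of "\<phi> g" "\<phi> h"] \<phi> by (simp add: pullback_pair hom_mult hom_in_carrier)
    qed
  qed
  moreover have "restrict c (nlists 2 (carrier L)) \<in> cohomology_class L 2 c"
    unfolding cohomology_class_2_iff[OF L]
    by (auto simp: pair_in_nlists_2 intro!: exI[of _ "\<lambda>_. 0"])
  ultimately have "(\<lambda>d. cohomology_class K 2 (pullback K 2 \<phi> d)) ` cohomology_class L 2 c
      = {cohomology_class K 2 (pullback K 2 \<phi> c)}"
    by blast
  then show ?thesis by (simp add: cohomology_pullback_def)
qed

lemma carrier_cohomology: "carrier (cohomology K n) = cohomology_class K n ` cocycles K n"
  by (auto simp: cohomology_def FactGroup_def RCOSETS_def cohomology_class_def r_coset_def)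

section \<open>The primitives attached to a basic action\<close>

lemma Phi_data_eq:
  assumes "Phi_data G N \<rho> A u" and "g \<in> carrier G" "h \<in> carrier G"
  shows "euler_cocycle [\<rho> g, \<rho> h] - A [N #>\<^bsub>G\<^esub> g, N #>\<^bsub>G\<^esub> h]
    = u [h] - u [g \<otimes>\<^bsub>G\<^esub> h] + u [g]"
  using assms by (simp add: Phi_data_def ball_nlists_2 pullback_pair flip: coboundary_1)

text \<open>Any cocycle \<open>B\<close> on the quotient that witnesses basicness can be normalized: the cocycle
  identity at \<open>(1, 1, g)\<close> and \<open>(g, 1, 1)\<close> shows that \<open>B(1, g)\<close> and \<open>B(g, 1)\<close> both equal
  \<open>B(1, 1)\<close>, and this constant may be subtracted because a constant \<open>2\<close>-cochain is the coboundary
  of the constant \<open>1\<close>-cochain.\<close>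

lemma Phi_data_exists:
  fixes G (structure)
  assumes G: "group G" and N: "N \<lhd> G" and basic: "\<rho> \<in> basic_homs G N"
  shows "\<exists>A u. Phi_data G N \<rho> A u"
proof -
  interpret group G by (rule G)
  interpret normal N G by (rule N)
  interpret quot: group "G Mod N" by (rule factorgroup_is_group)
  let ?p = "\<lambda>g. N #>\<^bsub>G\<^esub> g"
  have \<rho>: "\<rho> \<in> hom G Homeo_plus" using basic by (simp add: basic_homs_def)
  have p: "?p \<in> hom G (G Mod N)" by (rule r_coset_hom_Mod)
  from basic obtain B where B: "B \<in> cocycles (G Mod N) 2"
    and "cohomology_pullback G 2 \<rho> euler_class
      = cohomology_pullback G 2 ?p (cohomology_class (G Mod N) 2 B)"
    by (auto simp: basic_homs_def carrier_cohomology)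
  then have "cohomology_class G 2 (pullback G 2 \<rho> euler_cocycle) = cohomology_class G 2 (pullback G 2 ?p B)"
    using cohomology_pullback_class[OF monoid_axioms monoid_Homeo_plus \<rho>, of euler_cocycle]
      cohomology_pullback_class[OF monoid_axioms quot.monoid_axioms p, of B]
    by (simp add: euler_class_def)
  moreover have "pullback G 2 \<rho> euler_cocycle \<in> cohomology_class G 2 (pullback G 2 \<rho> euler_cocycle)"
    by (intro self_in_cohomology_class_2 monoid_axioms) (simp add: pullback_def)
  ultimately have "pullback G 2 \<rho> euler_cocycle \<in> cohomology_class G 2 (pullback G 2 ?p B)"
    by simp
  then obtain v where "\<forall>g\<in>carrier G. \<forall>h\<in>carrier G. pullback G 2 \<rho> euler_cocycle [g, h]
      = pullback G 2 ?p B [g, h] + (v h - v (g \<otimes> h) + v g)"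
    unfolding cohomology_class_2_iff[OF monoid_axioms] by blast
  then have v: "euler_cocycle [\<rho> g, \<rho> h] = B [?p g, ?p h] + (v h - v (g \<otimes> h) + v g)"
    if "g \<in> carrier G" "h \<in> carrier G" for g h
    using that by (simp add: pullback_pair)
  define a where "a = B [\<one>\<^bsub>G Mod N\<^esub>, \<one>\<^bsub>G Mod N\<^esub>]"
  define A where "A = (\<lambda>xs\<in>nlists 2 (carrier (G Mod N)). B xs - a)"
  \<comment> \<open>Adding the constant \<open>a\<close> to the primitive adds its coboundary, which is again \<open>a\<close>.\<close>
  define u where "u = (\<lambda>xs\<in>nlists 1 (carrier G). v (hd xs) + a)"
  have Bcoc: "B [h, k] - B [g \<otimes>\<^bsub>G Mod N\<^esub> h, k] + B [g, h \<otimes>\<^bsub>G Mod N\<^esub> k] - B [g, h] = 0"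
    if "g \<in> carrier (G Mod N)" "h \<in> carrier (G Mod N)" "k \<in> carrier (G Mod N)" for g h k
    using B that by (simp only: cocycles_2_iff)
  have A: "A [g, h] = B [g, h] - a" if "g \<in> carrier (G Mod N)" "h \<in> carrier (G Mod N)" for g h
    using that by (simp only: A_def restrict_apply' pair_in_nlists_2 simp_thms)
  have u: "u [g] = v g + a" if "g \<in> carrier G" for g
    using that by (simp add: u_def)
  have "A \<in> extensional (nlists 2 (carrier (G Mod N)))"
    unfolding A_def by (rule restrict_extensional)
  then have "A \<in> cocycles (G Mod N) 2"
    unfolding cocycles_2_iff
  proof (intro conjI ballI)
    fix g h k
    assume *: "g \<in> carrier (G Mod N)" "h \<in> carrier (G Mod N)" "k \<in> carrier (G Mod N)"
    show "A [h, k] - A [g \<otimes>\<^bsub>G Mod N\<^esub> h, k] + A [g, h \<otimes>\<^bsub>G Mod N\<^esub> k] - A [g, h] = 0"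
      using Bcoc[OF *] A[OF *(2,3)] A[OF quot.m_closed[OF *(1,2)] *(3)]
        A[OF *(1) quot.m_closed[OF *(2,3)]] A[OF *(1,2)]
      by linarith
  qed
  moreover have "normalized (G Mod N) 2 A"
  proof -
    have "A [g, h] = 0" if g: "g \<in> carrier (G Mod N)" and h: "h \<in> carrier (G Mod N)"
      and one: "g = \<one>\<^bsub>G Mod N\<^esub> \<or> h = \<one>\<^bsub>G Mod N\<^esub>" for g h
      using one
    proof
      assume "g = \<one>\<^bsub>G Mod N\<^esub>"
      then show ?thesis
        using Bcoc[OF quot.one_closed quot.one_closed h] A[OF g h] quot.l_one[OF h]
          quot.l_one[OF quot.one_closed]
        by (simp only: a_def)
    next
      assume "h = \<one>\<^bsub>G Mod N\<^esub>"
      then show ?thesis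
        using Bcoc[OF g quot.one_closed quot.one_closed] A[OF g h] quot.r_one[OF g]
          quot.l_one[OF quot.one_closed]
        by (simp only: a_def)
    qed
    then show ?thesis unfolding normalized_def ball_nlists_2 by auto
  qed
  moreover have "u \<in> cochains G 1" by (simp add: cochains_eq u_def)
  moreover have "pullback G 2 \<rho> euler_cocycle [g, h] - pullback G 2 ?p A [g, h] = coboundary G 1 u [g, h]"
    if gh: "g \<in> carrier G" "h \<in> carrier G" for g h
    using v[OF gh] A[OF hom_in_carrier[OF p gh(1)] hom_in_carrier[OF p gh(2)]] gh
    by (simp add: pullback_pair coboundary_1 u del: One_nat_def)
  ultimately have "Phi_data G N \<rho> A u"
    unfolding Phi_data_def ball_nlists_2 by blast
  then show ?thesis by blast
qed

lemma Phi_data_coset_vanish: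
  assumes G: "group G" and N: "N \<lhd> G" and D: "Phi_data G N \<rho> A u"
    and g: "g \<in> carrier G" and h: "h \<in> carrier G" and "g \<in> N \<or> h \<in> N"
  shows "A [N #>\<^bsub>G\<^esub> g, N #>\<^bsub>G\<^esub> h] = 0"
proof -
  interpret normal N G by (rule N)
  have p: "(\<lambda>g. N #>\<^bsub>G\<^esub> g) \<in> hom G (G Mod N)" by (rule r_coset_hom_Mod)
  have "N #>\<^bsub>G\<^esub> x = \<one>\<^bsub>G Mod N\<^esub>" if "x \<in> N" for x
    using that by (simp add: rcos_const)
  moreover have "\<forall>a\<in>carrier (G Mod N). \<forall>b\<in>carrier (G Mod N).
      \<one>\<^bsub>G Mod N\<^esub> = a \<or> \<one>\<^bsub>G Mod N\<^esub> = b \<longrightarrow> A [a, b] = 0"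
    using D unfolding Phi_data_def normalized_def ball_nlists_2 list.set insert_iff by blast
  ultimately show ?thesis
    using assms(6) hom_in_carrier[OF p g] hom_in_carrier[OF p h] by metis
qed

text \<open>The term coming from the quotient disappears as soon as one argument lies in \<open>N\<close>, because
  the cocycle is normalized: there \<open>u\<close> is a primitive of the Euler cocycle itself.\<close>

lemma Phi_data_euler_cocycle:
  assumes "group G" "N \<lhd> G" "Phi_data G N \<rho> A u"
    and "g \<in> carrier G" "h \<in> carrier G" "g \<in> N \<or> h \<in> N"
  shows "euler_cocycle [\<rho> g, \<rho> h] = u [h] - u [g \<otimes>\<^bsub>G\<^esub> h] + u [g]"
  using Phi_data_eq[OF assms(3-5)] Phi_data_coset_vanish[OF assms] by simp

text \<open>With \<open>y = g x g\<^sup>-\<^sup>1\<close>, the values of \<open>\<delta>u\<close> at \<open>(g, x)\<close> and \<open>(y, g)\<close> differ by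
  \<open>u(x) - u(y)\<close>, since \<open>g x = y g\<close>.\<close>

lemma Phi_data_conj_invariant:
  fixes G (structure)
  assumes G: "group G" and N: "N \<lhd> G" and \<rho>: "\<rho> \<in> hom G Homeo_plus"
    and D: "Phi_data G N \<rho> A u"
    and g: "g \<in> carrier G" and x: "x \<in> N"
  shows "u [g \<otimes>\<^bsub>G\<^esub> x \<otimes>\<^bsub>G\<^esub> inv\<^bsub>G\<^esub> g] = u [x]"
proof -
  interpret normal N G by (rule N)
  define y where "y = g \<otimes> x \<otimes> inv g"
  have y: "y \<in> N" unfolding y_def using g x by (rule inv_op_closed2)
  have car: "x \<in> carrier G" "y \<in> carrier G" using x y subset by auto
  have yg: "y \<otimes> g = g \<otimes> x"
    unfolding y_def using g car by (simp add: m_assoc)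
  then have "\<rho> g \<circ> \<rho> x = \<rho> y \<circ> \<rho> g"
    using hom_mult[OF \<rho>] g car by (metis (no_types) Homeo_plus_def monoid.select_convs(1))
  then have "euler_cocycle [\<rho> g, \<rho> x] = euler_cocycle [\<rho> y, \<rho> g]"
    using g car hom_in_carrier[OF \<rho>] by (intro euler_cocycle_conjugate)
  then show ?thesis
    using Phi_data_euler_cocycle[OF G N D g car(1)] Phi_data_euler_cocycle[OF G N D car(2) g] x y yg
    unfolding y_def by simp
qed

lemma additive_int_pow:
  fixes \<phi> :: "int \<Rightarrow> real"
  assumes add: "\<And>m n. \<phi> (m + n) = \<phi> m + \<phi> n"
  shows "\<phi> n = of_int n * \<phi> 1"
proof (induction n rule: int_induct[where k = 0])
  case base
  show ?case using add[of 0 0] by simp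
next
  case (step1 i)
  then show ?case using add[of i 1] by (simp add: algebra_simps)
next
  case (step2 i)
  then show ?case using add[of "i - 1" 1] by (simp add: algebra_simps)
qed

text \<open>Homogeneity comes from the cyclic group generated by a single element: its elements commute,
  so the Euler cocycle vanishes there and \<open>u\<close> is additive along the powers.\<close>

lemma Phi_data_quasimorphism:
  fixes G (structure)
  assumes G: "group G" and N: "N \<lhd> G" and \<rho>: "\<rho> \<in> hom G Homeo_plus"
    and D: "Phi_data G N \<rho> A u"
  shows "(\<lambda>x\<in>N. u [x]) \<in> carrier (invariant_quasimorphisms G N)"
proof -
  interpret normal N G by (rule N)
  let ?\<mu> = "\<lambda>x\<in>N. u [x]"
  have eq: "euler_cocycle [\<rho> g, \<rho> h] = u [h] - u [g \<otimes> h] + u [g]" if "g \<in> N" "h \<in> N" for g h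
    using Phi_data_euler_cocycle[OF G N D] that subset by auto
  have "\<bar>?\<mu> (g \<otimes> h) - ?\<mu> g - ?\<mu> h\<bar> \<le> 4" if gh: "g \<in> N" "h \<in> N" for g h
  proof -
    have "\<bar>euler_cocycle [\<rho> g, \<rho> h]\<bar> \<le> 4"
      using gh subset hom_in_carrier[OF \<rho>] by (intro euler_cocycle_bounded) auto
    then show ?thesis using gh eq[OF gh] by simp
  qed
  moreover have "?\<mu> (g [^]\<^bsub>G\<lparr>carrier := N\<rparr>\<^esub> n) = of_int n * ?\<mu> g" if g: "g \<in> N" for g and n :: int
  proof -
    define \<phi> where "\<phi> n = u [g [^] n]" for n :: int
    have gG: "g \<in> carrier G" using g subset by auto
    have pow: "g [^] n \<in> N" for n :: int
      using g by (rule subgroup_int_pow_closed[OF subgroup_axioms])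
    have "\<phi> (m + n) = \<phi> m + \<phi> n" for m n
    proof -
      have "\<rho> (g [^] m) \<circ> \<rho> (g [^] n) = \<rho> (g [^] (m + n))"
        "\<rho> (g [^] n) \<circ> \<rho> (g [^] m) = \<rho> (g [^] (n + m))"
        using hom_mult[OF \<rho>, of "g [^] m" "g [^] n"] hom_mult[OF \<rho>, of "g [^] n" "g [^] m"] gG
        by (simp_all add: Homeo_plus_def int_pow_mult)
      then have "euler_cocycle [\<rho> (g [^] m), \<rho> (g [^] n)] = 0"
        using gG hom_in_carrier[OF \<rho>] by (intro euler_cocycle_commuting) (simp_all add: add.commute)
      then show ?thesis
        using eq[OF pow[of m] pow[of n]] gG by (simp add: \<phi>_def int_pow_mult)
    qed
    then have "\<phi> n = of_int n * \<phi> 1" by (rule additive_int_pow)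
    then show ?thesis
      using g gG pow[of n] int_pow_consistent[OF subgroup_axioms g, of n] by (simp add: \<phi>_def)
  qed
  moreover have "conj_invariant G N ?\<mu>"
    using Phi_data_conj_invariant[OF G N \<rho> D] by (simp add: conj_invariant_def inv_op_closed2)
  ultimately show ?thesis
    by (auto simp: invariant_quasimorphisms_def homogeneous_quasimorphism_def)
qed

text \<open>Two primitives differ on \<open>N\<close> by a function with vanishing coboundary, that is, by a
  homomorphism, which inherits invariance from its two summands.\<close>

lemma Phi_data_difference:
  fixes G (structure)
  assumes G: "group G" and N: "N \<lhd> G" and \<rho>: "\<rho> \<in> hom G Homeo_plus"
    and D: "Phi_data G N \<rho> A u" and D': "Phi_data G N \<rho> A' u'"
  shows "(\<lambda>x\<in>N. u [x] - u' [x]) \<in> invariant_homs G N"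
proof -
  interpret normal N G by (rule N)
  have "u [x \<otimes> y] - u' [x \<otimes> y] = (u [x] - u' [x]) + (u [y] - u' [y])" if "x \<in> N" "y \<in> N" for x y
  proof -
    have xy: "x \<in> carrier G" "y \<in> carrier G" "x \<in> N \<or> y \<in> N" using that subset by auto
    show ?thesis
      using Phi_data_euler_cocycle[OF G N D xy] Phi_data_euler_cocycle[OF G N D' xy] by simp
  qed
  then have "(\<lambda>x\<in>N. u [x] - u' [x]) \<in> hom (G\<lparr>carrier := N\<rparr>) real_group"
    by (simp add: hom_def)
  moreover have "conj_invariant G N (\<lambda>x\<in>N. u [x] - u' [x])"
    using Phi_data_conj_invariant[OF G N \<rho> D] Phi_data_conj_invariant[OF G N \<rho> D']
    by (simp add: conj_invariant_def inv_op_closed2)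
  ultimately show ?thesis by (simp add: invariant_homs_def)
qed

lemma invariant_homs_add:
  assumes N: "N \<lhd> G" and "\<mu> \<in> invariant_homs G N" "\<nu> \<in> invariant_homs G N"
  shows "(\<lambda>x\<in>N. \<mu> x + \<nu> x) \<in> invariant_homs G N"
proof -
  interpret normal N G by (rule N)
  show ?thesis
    using assms(2,3) by (simp add: invariant_homs_def hom_def conj_invariant_def inv_op_closed2)
qed

lemma Phi_data_coset_subset:
  assumes G: "group G" and N: "N \<lhd> G" and \<rho>: "\<rho> \<in> hom G Homeo_plus"
    and D: "Phi_data G N \<rho> A u" and D': "Phi_data G N \<rho> A' u'"
  shows "invariant_homs G N #>\<^bsub>invariant_quasimorphisms G N\<^esub> (\<lambda>x\<in>N. u [x])
    \<subseteq> invariant_homs G N #>\<^bsub>invariant_quasimorphisms G N\<^esub> (\<lambda>x\<in>N. u' [x])"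
proof
  fix \<nu> assume "\<nu> \<in> invariant_homs G N #>\<^bsub>invariant_quasimorphisms G N\<^esub> (\<lambda>x\<in>N. u [x])"
  then obtain \<mu> where \<mu>: "\<mu> \<in> invariant_homs G N" and \<nu>: "\<nu> = (\<lambda>x\<in>N. \<mu> x + u [x])"
    by (auto simp: r_coset_def invariant_quasimorphisms_def cong: restrict_cong)
  define \<mu>' where "\<mu>' = (\<lambda>x\<in>N. \<mu> x + (\<lambda>x\<in>N. u [x] - u' [x]) x)"
  have "\<mu>' \<in> invariant_homs G N"
    unfolding \<mu>'_def by (intro invariant_homs_add N \<mu> Phi_data_difference[OF G N \<rho> D D'])
  moreover have "\<nu> = \<mu>' \<otimes>\<^bsub>invariant_quasimorphisms G N\<^esub> (\<lambda>x\<in>N. u' [x])"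
    by (auto simp: \<nu> \<mu>'_def invariant_quasimorphisms_def fun_eq_iff)
  ultimately show "\<nu> \<in> invariant_homs G N #>\<^bsub>invariant_quasimorphisms G N\<^esub> (\<lambda>x\<in>N. u' [x])"
    by (auto simp: r_coset_def)
qed

lemma Phi_eq:
  assumes G: "group G" and N: "N \<lhd> G" and \<rho>: "\<rho> \<in> hom G Homeo_plus"
    and D: "Phi_data G N \<rho> A u"
  shows "Phi G N \<rho> = invariant_homs G N #>\<^bsub>invariant_quasimorphisms G N\<^esub> (\<lambda>x\<in>N. u [x])"
  unfolding Phi_def
proof (rule the_equality)
  fix c assume "\<exists>A' u'. Phi_data G N \<rho> A' u' \<and>
    c = invariant_homs G N #>\<^bsub>invariant_quasimorphisms G N\<^esub> (\<lambda>x\<in>N. u' [x])"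
  then show "c = invariant_homs G N #>\<^bsub>invariant_quasimorphisms G N\<^esub> (\<lambda>x\<in>N. u [x])"
    using Phi_data_coset_subset[OF G N \<rho> D] Phi_data_coset_subset[OF G N \<rho> _ D] by blast
qed (use D in blast)

lemma Phi_in_target:
  assumes G: "group G" and N: "N \<lhd> G" and basic: "\<rho> \<in> basic_homs G N"
  shows "Phi G N \<rho> \<in> carrier (Phi_target G N)"
proof -
  have \<rho>: "\<rho> \<in> hom G Homeo_plus" using basic by (simp add: basic_homs_def)
  from Phi_data_exists[OF assms] obtain A u where D: "Phi_data G N \<rho> A u" by blast
  from Phi_data_quasimorphism[OF G N \<rho> D] show ?thesis
    unfolding Phi_eq[OF G N \<rho> D] by (auto simp: FactGroup_def RCOSETS_def)
qed

section \<open>Invariance under semi-conjugacy\<close>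

text \<open>Only the values of the pulled back Euler cocycle enter the conditions on \<open>(A, u)\<close>, so these
  conditions are literally the same for semi-conjugate actions.\<close>

lemma semiconjugate_imp_Phi_eq:
  assumes "\<rho>\<^sub>1 \<in> hom G Homeo_plus" "\<rho>\<^sub>2 \<in> hom G Homeo_plus" "semiconjugate G \<rho>\<^sub>1 \<rho>\<^sub>2"
  shows "Phi G N \<rho>\<^sub>1 = Phi G N \<rho>\<^sub>2"
proof -
  have "Phi_data G N \<rho>\<^sub>1 = Phi_data G N \<rho>\<^sub>2"
    using semiconjugate_imp_euler_cocycle_eq[OF assms]
    by (intro ext) (simp add: Phi_data_def ball_nlists_2 pullback_pair)
  then show ?thesis by (simp add: Phi_def)
qed

lemma semiconjugate_refl:
  assumes "\<rho> \<in> hom G Homeo_plus"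
  shows "semiconjugate G \<rho> \<rho>"
proof -
  have "\<exists>F. F \<in> lifts (\<rho> g)" if "g \<in> carrier G" for g
    using lifts_nonempty[OF hom_in_carrier[OF assms that]] .
  then have "\<exists>R\<in>lifts (\<rho> g). \<exists>R'\<in>lifts (\<rho> g). \<forall>x. R (id x) = id (R' x)"
    if "g \<in> carrier G" for g
    using that by (metis id_apply)
  then show ?thesis
    unfolding semiconjugate_def by (intro exI[of _ id]) (auto simp: mono_def)
qed

theorem proposition8p5:
  fixes G :: "('a, 'm) monoid_scheme" and N :: "'a set"
  assumes "group G" and "N \<lhd> G" and "N \<subseteq> derived G (carrier G)"
  shows "(\<forall>\<rho>\<^sub>1\<in>basic_homs G N. \<forall>\<rho>\<^sub>2\<in>basic_homs G N.
            semiconjugate G \<rho>\<^sub>1 \<rho>\<^sub>2 \<longrightarrow> Phi G N \<rho>\<^sub>1 = Phi G N \<rho>\<^sub>2) \<and>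
         (\<exists>!\<Psi>. \<Psi> \<in> basic_homs G N // semiconjugacy G N \<rightarrow>\<^sub>E carrier (Phi_target G N) \<and>
            (\<forall>\<rho>\<in>basic_homs G N. \<Psi> (semiconjugacy G N `` {\<rho>}) = Phi G N \<rho>))"
proof
  let ?H = "basic_homs G N" and ?R = "semiconjugacy G N"
  have hom: "\<rho> \<in> hom G Homeo_plus" if "\<rho> \<in> ?H" for \<rho>
    using that by (simp add: basic_homs_def)
  show inv: "\<forall>\<rho>\<^sub>1\<in>?H. \<forall>\<rho>\<^sub>2\<in>?H. semiconjugate G \<rho>\<^sub>1 \<rho>\<^sub>2 \<longrightarrow> Phi G N \<rho>\<^sub>1 = Phi G N \<rho>\<^sub>2"
    using semiconjugate_imp_Phi_eq hom by blast
  have refl: "\<rho> \<in> ?R `` {\<rho>}" if "\<rho> \<in> ?H" for \<rho>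
    using that semiconjugate_refl[OF hom] by (simp add: semiconjugacy_def)
  \<comment> \<open>Each member of the class of \<open>\<rho>\<close> is related to \<open>\<rho>\<close> itself, so any choice of a representative
    gives the value at \<open>\<rho>\<close>; reflexivity ensures that there is one to choose.\<close>
  define \<Psi> where "\<Psi> = (\<lambda>c\<in>?H // ?R. Phi G N (SOME \<rho>. \<rho> \<in> c))"
  have val: "\<Psi> (?R `` {\<rho>}) = Phi G N \<rho>" if \<rho>: "\<rho> \<in> ?H" for \<rho>
  proof -
    define \<sigma> where "\<sigma> = (SOME \<sigma>. \<sigma> \<in> ?R `` {\<rho>})"
    have "\<sigma> \<in> ?R `` {\<rho>}" using refl[OF \<rho>] unfolding \<sigma>_def some_in_eq by blast
    then have "Phi G N \<rho> = Phi G N \<sigma>"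
      using inv by (auto simp: semiconjugacy_def)
    then show ?thesis using quotientI[OF \<rho>] by (simp add: \<Psi>_def \<sigma>_def)
  qed
  show "\<exists>!\<Psi>. \<Psi> \<in> ?H // ?R \<rightarrow>\<^sub>E carrier (Phi_target G N) \<and>
      (\<forall>\<rho>\<in>?H. \<Psi> (?R `` {\<rho>}) = Phi G N \<rho>)"
  proof (rule ex1I[of _ \<Psi>], intro conjI)
    show "\<Psi> \<in> ?H // ?R \<rightarrow>\<^sub>E carrier (Phi_target G N)"
    proof (rule PiE_I)
      fix c assume "c \<in> ?H // ?R"
      then show "\<Psi> c \<in> carrier (Phi_target G N)"
        using val Phi_in_target[OF assms(1,2)] by (auto elim!: quotientE)
    qed (simp add: \<Psi>_def)
    show "\<forall>\<rho>\<in>?H. \<Psi> (?R `` {\<rho>}) = Phi G N \<rho>" using val by blast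
  next
    fix \<Psi>' assume \<Psi>': "\<Psi>' \<in> ?H // ?R \<rightarrow>\<^sub>E carrier (Phi_target G N) \<and>
      (\<forall>\<rho>\<in>?H. \<Psi>' (?R `` {\<rho>}) = Phi G N \<rho>)"
    show "\<Psi>' = \<Psi>"
    proof (rule extensionalityI[of _ "?H // ?R"])
      fix c assume "c \<in> ?H // ?R"
      then show "\<Psi>' c = \<Psi> c" using val \<Psi>' by (auto elim!: quotientE)
    qed (use \<Psi>' in \<open>auto simp: \<Psi>_def PiE_def\<close>)
  qed
qed

end
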